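(* Let $\mathbf{k}$ be a commutative ring, $n\in\mathbb{N}$ and $\alpha\in\operatorname{Comp}(n)$. Then the antipode $S$ of $\operatorname{QSym}$ satisfies $$S(\eta_\alpha)=(-1)^{\ell(\alpha)}\,\eta_{\operatorname{rev}\alpha}.$$
   Context: $\mathbb{N}=\{0,1,2,\ldots\}$. A composition of $n\in\mathbb{N}$ is a finite sequence $\alpha=(\alpha_1,\ldots,\alpha_p)$ of positive integers with sum $n$; its length is $\ell(\alpha)=p$, and $\operatorname{Comp}(n)$ is the set of compositions of $n$. The reversal of $\alpha$ is $\operatorname{rev}\alpha=(\alpha_p,\alpha_{p-1},\ldots,\alpha_1)$. For $\alpha\in\operatorname{Comp}(n)$, $\operatorname{Des}(\alpha)=\{\alpha_1,\alpha_1+\alpha_2,\ldots,\alpha_1+\cdots+\alpha_{p-1}\}\subseteq\{1,\ldots,n-1\}$. $\operatorname{QSym}\subseteq\mathbf{k}[[x_1,x_2,\ldots]]$ is the ring of quasisymmetric functions over $\mathbf{k}$, with $\mathbf{k}$-module basis the monomial quasisymmetric functions $M_\alpha=\sum_{i_1<\cdots<i_p}x_{i_1}^{\alpha_1}\cdots x_{i_p}^{\alpha_p}$. The antipode $S:\operatorname{QSym}\to\operatorname{QSym}$ is the unique $\mathbf{k}$-linear map such that $S(M_\alpha)=(-1)^{\ell(\alpha)}\sum_{\gamma\in\operatorname{Comp}(n),\ \operatorname{Des}(\gamma)\subseteq\operatorname{Des}(\operatorname{rev}\alpha)}M_\gamma$ for all $n\in\mathbb{N}$ and $\alpha\in\operatorname{Comp}(n)$.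 For $\alpha\in\operatorname{Comp}(n)$, the enriched monomial function is $\eta_\alpha=\sum_{\beta\in\operatorname{Comp}(n),\ \operatorname{Des}(\beta)\subseteq\operatorname{Des}(\alpha)}2^{\ell(\beta)}M_\beta$. *)

theory Defs
  imports "HOL-Library.Poly_Mapping" "HOL-Library.Function_Algebras" "HOL-Library.FuncSet"
begin

section \<open>Compositions\<close>

definition Comp :: "nat \<Rightarrow> nat list set" where
  "Comp n = {\<alpha>. (\<forall>a\<in>set \<alpha>. 0 < a) \<and> sum_list \<alpha> = n}"

definition Des :: "nat list \<Rightarrow> nat set" where
  "Des \<alpha> = {sum_list (take k \<alpha>) | k. 1 \<le> k \<and> k < length \<alpha>}"


section \<open>Quasisymmetric functions\<close>

text \<open>
  A monomial is a finitely supported map from variable indices to exponents; the index \<open>i\<close> stands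
  for the variable \<open>x\<^sub>i\<^sub>+\<^sub>1\<close>. A formal power series is the family of its coefficients. Only the
  module structure is needed: addition is pointwise, and the pointwise product that
  \<open>Function_Algebras\<close> puts on this type is never used.

  The sort \<open>{comm_ring, semiring_numeral}\<close> describes the commutative rings with unity. Unlike
  \<open>comm_ring_1\<close>, it does not exclude the zero ring.
\<close>

type_synonym monomial = "nat \<Rightarrow>\<^sub>0 nat"
type_synonym 'k power_series = "monomial \<Rightarrow> 'k"

definition scale :: "'k::times \<Rightarrow> 'k power_series \<Rightarrow> 'k power_series" where
  "scale c f = (\<lambda>m. c * f m)"

definition mdeg :: "monomial \<Rightarrow> nat" where
  "mdeg m = (\<Sum>i\<in>Poly_Mapping.keys m. Poly_Mapping.lookup m i)"

definition monom :: "nat list \<Rightarrow> nat list \<Rightarrow> monomial" where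
  "monom js \<alpha> = (\<Sum>k<length \<alpha>. Poly_Mapping.single (js ! k) (\<alpha> ! k))"

text \<open>The strictly increasing index sequences of length \<open>p\<close>.\<close>

definition incr_seqs :: "nat \<Rightarrow> nat list set" where
  "incr_seqs p = {js. length js = p \<and> sorted_wrt (<) js}"

definition QSym :: "'k::zero power_series set" where
  "QSym = {f. (\<exists>d. \<forall>m. f m \<noteq> 0 \<longrightarrow> mdeg m \<le> d) \<and>
              (\<forall>\<alpha> ks js. (\<forall>a\<in>set \<alpha>. 0 < a) \<longrightarrow> ks \<in> incr_seqs (length \<alpha>) \<longrightarrow>
                 js \<in> incr_seqs (length \<alpha>) \<longrightarrow> f (monom ks \<alpha>) = f (monom js \<alpha>))}"

text \<open>
  \<open>M \<alpha>\<close> is an infinite sum of monomials, taken coefficientwise: the coefficient of \<open>m\<close> collects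
  a \<open>1\<close> for every index sequence whose monomial is \<open>m\<close>. There is at most one, see \<open>M_eq\<close> below.
\<close>

definition M :: "nat list \<Rightarrow> 'k::{comm_ring, semiring_numeral} power_series" where
  "M \<alpha> = (\<lambda>m. \<Sum>js\<in>{js \<in> incr_seqs (length \<alpha>). monom js \<alpha> = m}. 1)"

definition eta :: "nat list \<Rightarrow> 'k::{comm_ring, semiring_numeral} power_series" where
  "eta \<alpha> = (\<Sum>\<beta>\<in>{\<beta> \<in> Comp (sum_list \<alpha>). Des \<beta> \<subseteq> Des \<alpha>}. scale (2 ^ length \<beta>) (M \<beta>))"


section \<open>The antipode\<close>

definition linear_on_QSym ::
    "('k::{comm_ring, semiring_numeral} power_series \<Rightarrow> 'k power_series) \<Rightarrow> bool" where
  "linear_on_QSym S \<longleftrightarrow>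
     (\<forall>f\<in>QSym. \<forall>g\<in>QSym. S (f + g) = S f + S g) \<and> (\<forall>c. \<forall>f\<in>QSym. S (scale c f) = scale c (S f))"

definition is_antipode ::
    "('k::{comm_ring, semiring_numeral} power_series \<Rightarrow> 'k power_series) \<Rightarrow> bool" where
  "is_antipode S \<longleftrightarrow> S \<in> QSym \<rightarrow>\<^sub>E QSym \<and> linear_on_QSym S \<and>
     (\<forall>n. \<forall>\<alpha>\<in>Comp n. S (M \<alpha>) =
        scale ((- 1) ^ length \<alpha>) (\<Sum>\<gamma>\<in>{\<gamma> \<in> Comp n. Des \<gamma> \<subseteq> Des (rev \<alpha>)}. M \<gamma>))"

text \<open>
  The type of \<open>antipode\<close> is a total function space, so uniqueness only makes sense among maps with
  a fixed value outside \<open>QSym\<close>; this is what \<open>\<rightarrow>\<^sub>E\<close> provides. Unique existence is \<open>ex1_antipode\<close>.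
\<close>

definition antipode :: "'k::{comm_ring, semiring_numeral} power_series \<Rightarrow> 'k power_series" where
  "antipode = (THE S. is_antipode S)"

subsection \<open>Well-definedness\<close>

text \<open>The exponents of a monomial, read in the order of the variables.\<close>

definition expo :: "monomial \<Rightarrow> nat list" where
  "expo m = map (Poly_Mapping.lookup m) (sorted_list_of_set (Poly_Mapping.keys m))"

lemma lookup_monom:
  assumes "js \<in> incr_seqs (length \<alpha>)"
  shows "k < length \<alpha> \<Longrightarrow> Poly_Mapping.lookup (monom js \<alpha>) (js ! k) = \<alpha> ! k"
    and "j \<notin> set js \<Longrightarrow> Poly_Mapping.lookup (monom js \<alpha>) j = 0"
proof -
  have len: "length js = length \<alpha>" and dist: "distinct js"
    using assms by (auto simp: incr_seqs_def strict_sorted_iff)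
  { assume k: "k < length \<alpha>"
    have "Poly_Mapping.lookup (monom js \<alpha>) (js ! k) = (\<Sum>i<length \<alpha>. if i = k then \<alpha> ! k else 0)"
      unfolding monom_def lookup_sum
      by (intro sum.cong refl)
        (use k len dist in \<open>auto simp: lookup_single when_def nth_eq_iff_index_eq\<close>)
    then show "Poly_Mapping.lookup (monom js \<alpha>) (js ! k) = \<alpha> ! k" using k by simp }
  { assume j: "j \<notin> set js"
    show "Poly_Mapping.lookup (monom js \<alpha>) j = 0"
      unfolding monom_def lookup_sum
      by (intro sum.neutral ballI) (use j len in \<open>auto simp: lookup_single when_def\<close>) }
qed

lemma monom_inverse:
  assumes js: "js \<in> incr_seqs (length \<alpha>)" and pos: "\<forall>a\<in>set \<alpha>. 0 < a"
  shows "sorted_list_of_set (Poly_Mapping.keys (monom js \<alpha>)) = js" and "expo (monom js \<alpha>) = \<alpha>"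
proof -
  have len: "length js = length \<alpha>" and srt: "sorted_wrt (<) js"
    using js by (auto simp: incr_seqs_def)
  have "Poly_Mapping.keys (monom js \<alpha>) = set js"
  proof (intro set_eqI iffI)
    fix j assume "j \<in> Poly_Mapping.keys (monom js \<alpha>)"
    then show "j \<in> set js" using lookup_monom(2)[OF js] by (metis in_keys_iff)
  next
    fix j assume "j \<in> set js"
    then obtain k where "k < length \<alpha>" "j = js ! k" using len by (metis in_set_conv_nth)
    then show "j \<in> Poly_Mapping.keys (monom js \<alpha>)"
      using lookup_monom(1)[OF js] pos by (simp add: in_keys_iff)
  qed
  then show *: "sorted_list_of_set (Poly_Mapping.keys (monom js \<alpha>)) = js"
    using srt by (simp add: strict_sorted_iff sorted_distinct_set_unique)
  show "expo (monom js \<alpha>) = \<alpha>"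
    unfolding expo_def * by (rule nth_equalityI) (use len lookup_monom(1)[OF js] in auto)
qed

lemma expo_pos: "a \<in> set (expo m) \<Longrightarrow> 0 < a"
  by (auto simp: expo_def in_keys_iff)

lemma sum_list_expo: "sum_list (expo m) = mdeg m"
  by (simp add: expo_def mdeg_def sum_list_distinct_conv_sum_set)

lemma expo_Comp: "expo m \<in> Comp (mdeg m)"
  by (simp add: Comp_def expo_pos sum_list_expo)

lemma incr_seqs_expo: "sorted_list_of_set (Poly_Mapping.keys m) \<in> incr_seqs (length (expo m))"
  by (simp add: incr_seqs_def expo_def)

lemma monom_expo: "monom (sorted_list_of_set (Poly_Mapping.keys m)) (expo m) = m"
  (is "monom ?js _ = m")
proof (rule poly_mapping_eqI)
  fix j
  show "Poly_Mapping.lookup (monom ?js (expo m)) j = Poly_Mapping.lookup m j"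
  proof (cases "j \<in> Poly_Mapping.keys m")
    case True
    then have "j \<in> set ?js" by simp
    then obtain k where k: "k < length ?js" "j = ?js ! k" by (metis in_set_conv_nth)
    with lookup_monom(1)[OF incr_seqs_expo, of k m] show ?thesis by (simp add: expo_def)
  next
    case False
    with lookup_monom(2)[OF incr_seqs_expo, of j m] show ?thesis by (simp add: in_keys_iff)
  qed
qed

lemma M_eq:
  assumes "\<forall>a\<in>set \<alpha>. 0 < a"
  shows "M \<alpha> m = (if expo m = \<alpha> then 1 else 0 :: 'k::{comm_ring, semiring_numeral})"
proof (cases "expo m = \<alpha>")
  case True
  have "{js \<in> incr_seqs (length \<alpha>). monom js \<alpha> = m} = {sorted_list_of_set (Poly_Mapping.keys m)}"
    using monom_inverse(1)[OF _ assms] monom_expo[of m] incr_seqs_expo[of m] True by fastforce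
  then show ?thesis using True by (simp add: M_def)
next
  case False
  then have "{js \<in> incr_seqs (length \<alpha>). monom js \<alpha> = m} = {}"
    using monom_inverse(2)[OF _ assms] by auto
  then show ?thesis unfolding M_def using False by (simp only: sum.empty if_False)
qed

lemma finite_Comp: "finite (Comp n)"
proof (rule finite_subset)
  have "length \<alpha> \<le> sum_list \<alpha>" if "\<forall>a\<in>set \<alpha>. 0 < a" for \<alpha> :: "nat list"
    using that by (induction \<alpha>) auto
  then show "Comp n \<subseteq> {\<alpha>. set \<alpha> \<subseteq> {..n} \<and> length \<alpha> \<le> n}"
    using member_le_sum_list by (fastforce simp: Comp_def)
  show "finite {\<alpha>. set \<alpha> \<subseteq> {..n} \<and> length \<alpha> \<le> n}"
    by (rule finite_lists_length_le) simp
qed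

lemma QSym_iff:
  "f \<in> QSym \<longleftrightarrow> (\<exists>d. \<forall>m. f m \<noteq> 0 \<longrightarrow> mdeg m \<le> d) \<and> (\<forall>m m'. expo m = expo m' \<longrightarrow> f m = f m')"
proof -
  have "(\<forall>\<alpha> ks js. (\<forall>a\<in>set \<alpha>. 0 < a) \<longrightarrow> ks \<in> incr_seqs (length \<alpha>) \<longrightarrow>
            js \<in> incr_seqs (length \<alpha>) \<longrightarrow> f (monom ks \<alpha>) = f (monom js \<alpha>))
        \<longleftrightarrow> (\<forall>m m'. expo m = expo m' \<longrightarrow> f m = f m')" (is "?A \<longleftrightarrow> ?B")
  proof
    assume A: ?A
    show ?B
    proof (intro allI impI)
      fix m m' assume e: "expo m = expo m'"
      show "f m = f m'"
        using A expo_pos incr_seqs_expo[of m] incr_seqs_expo[of m'] monom_expo[of m] monom_expo[of m'] e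
        by metis
    qed
  next
    assume B: ?B
    show ?A using B monom_inverse(2) by simp
  qed
  then show ?thesis by (simp add: QSym_def)
qed

lemma QSym_bounded: "f \<in> QSym \<Longrightarrow> \<exists>d. \<forall>m. f m \<noteq> 0 \<longrightarrow> mdeg m \<le> d"
  by (simp add: QSym_def)

lemma zero_QSym: "0 \<in> QSym"
  by (simp add: QSym_iff)

lemma add_QSym:
  fixes f g :: "'k::comm_monoid_add power_series"
  assumes "f \<in> QSym" "g \<in> QSym"
  shows "f + g \<in> QSym"
proof -
  obtain d d' where "\<forall>m. f m \<noteq> 0 \<longrightarrow> mdeg m \<le> d" "\<forall>m. g m \<noteq> 0 \<longrightarrow> mdeg m \<le> d'"
    using assms QSym_bounded by metis
  then have "\<forall>m. (f + g) m \<noteq> 0 \<longrightarrow> mdeg m \<le> max d d'"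
    unfolding plus_fun_apply by (metis add_0 le_max_iff_disj)
  moreover have "\<forall>m m'. expo m = expo m' \<longrightarrow> (f + g) m = (f + g) m'"
    using assms[unfolded QSym_iff, THEN conjunct2] unfolding plus_fun_apply by metis
  ultimately show ?thesis unfolding QSym_iff by blast
qed

lemma scale_QSym:
  fixes f :: "'k::mult_zero power_series"
  shows "f \<in> QSym \<Longrightarrow> scale c f \<in> QSym"
  unfolding QSym_iff scale_def by (metis mult_zero_right)

lemma sum_QSym:
  fixes F :: "'a \<Rightarrow> 'k::comm_monoid_add power_series"
  shows "(\<And>x. x \<in> A \<Longrightarrow> F x \<in> QSym) \<Longrightarrow> sum F A \<in> QSym"
  by (induction A rule: infinite_finite_induct) (simp_all add: zero_QSym add_QSym)

lemma M_QSym: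
  assumes "\<alpha> \<in> Comp n"
  shows "(M \<alpha> :: 'k::{comm_ring, semiring_numeral} power_series) \<in> QSym"
proof -
  have "\<forall>a\<in>set \<alpha>. 0 < a" using assms by (simp add: Comp_def)
  note M = M_eq[OF this, where 'k = 'k]
  have "\<forall>m. M \<alpha> m \<noteq> (0::'k) \<longrightarrow> mdeg m \<le> n"
    using assms by (auto simp: M Comp_def simp flip: sum_list_expo)
  moreover have "\<forall>m m'. expo m = expo m' \<longrightarrow> M \<alpha> m = (M \<alpha> m' :: 'k)" by (simp add: M)
  ultimately show ?thesis unfolding QSym_iff by blast
qed

lemma sum_power_series_apply:
  fixes F :: "'a \<Rightarrow> 'k::comm_monoid_add power_series"
  shows "sum F A m = (\<Sum>x\<in>A. F x m)"
  by (induction A rule: infinite_finite_induct) auto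

lemma expo_std:
  "\<forall>a\<in>set \<alpha>. 0 < a \<Longrightarrow> expo (monom [0..<length \<alpha>] \<alpha>) = \<alpha>"
  by (rule monom_inverse(2)) (auto simp: incr_seqs_def)

lemma QSym_expansion:
  fixes f :: "'k::{comm_ring, semiring_numeral} power_series"
  assumes f: "f \<in> QSym" and d: "\<forall>m. f m \<noteq> 0 \<longrightarrow> mdeg m \<le> d"
  shows "f = (\<Sum>\<alpha>\<in>(\<Union>n\<le>d. Comp n). scale (f (monom [0..<length \<alpha>] \<alpha>)) (M \<alpha>))"
proof
  fix m
  let ?A = "\<Union>n\<le>d. Comp n"
  have fin: "finite ?A" by (simp add: finite_Comp)
  have pos: "\<forall>a\<in>set \<alpha>. 0 < a" if "\<alpha> \<in> ?A" for \<alpha> using that by (auto simp: Comp_def)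
  have val: "f (monom [0..<length (expo m)] (expo m)) = f m"
    using f[unfolded QSym_iff, THEN conjunct2] expo_std[of "expo m"] expo_pos by blast
  have "(\<Sum>\<alpha>\<in>?A. scale (f (monom [0..<length \<alpha>] \<alpha>)) (M \<alpha>)) m
      = (\<Sum>\<alpha>\<in>?A. if \<alpha> = expo m then f m else 0)"
    unfolding sum_power_series_apply
    by (intro sum.cong refl) (use val in \<open>auto simp: scale_def M_eq pos\<close>)
  also have "\<dots> = (if expo m \<in> ?A then f m else 0)" using fin by simp
  also have "\<dots> = f m"
    using d expo_Comp[of m] by auto
  finally show "f m = (\<Sum>\<alpha>\<in>?A. scale (f (monom [0..<length \<alpha>] \<alpha>)) (M \<alpha>)) m" ..
qed

lemma linear_on_QSym_sum:
  assumes S: "linear_on_QSym S" and F: "\<And>x. x \<in> A \<Longrightarrow> F x \<in> QSym"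
  shows "S (\<Sum>x\<in>A. scale (c x) (F x)) = (\<Sum>x\<in>A. scale (c x) (S (F x)))"
proof -
  have S0: "S 0 = 0"
    using S[unfolded linear_on_QSym_def, THEN conjunct1, rule_format, OF zero_QSym zero_QSym]
    by simp
  show ?thesis using F
  proof (induction A rule: infinite_finite_induct)
    case (insert x A)
    have "S (scale (c x) (F x) + (\<Sum>x\<in>A. scale (c x) (F x)))
        = S (scale (c x) (F x)) + S (\<Sum>x\<in>A. scale (c x) (F x))"
      using S insert.prems unfolding linear_on_QSym_def by (simp add: scale_QSym sum_QSym)
    also have "S (scale (c x) (F x)) = scale (c x) (S (F x))"
      using S insert.prems unfolding linear_on_QSym_def by simp
    finally show ?case using insert by simp
  qed (simp_all add: S0)
qed

lemma is_antipode_unique: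
  assumes S: "is_antipode S" and T: "is_antipode T"
  shows "S = T"
proof
  fix f
  show "S f = T f"
  proof (cases "f \<in> QSym")
    case False
    then show ?thesis using S T unfolding is_antipode_def by (auto simp: PiE_def extensional_def)
  next
    case True
    then obtain d where "\<forall>m. f m \<noteq> 0 \<longrightarrow> mdeg m \<le> d" using QSym_bounded[OF True] by blast
    note exp = QSym_expansion[OF True this]
    have *: "U f = (\<Sum>\<alpha>\<in>(\<Union>n\<le>d. Comp n). scale (f (monom [0..<length \<alpha>] \<alpha>)) (U (M \<alpha>)))"
      if "is_antipode U" for U
      unfolding arg_cong[OF exp, of U]
      by (rule linear_on_QSym_sum) (use that M_QSym in \<open>auto simp: is_antipode_def\<close>)
    have "S (M \<alpha>) = T (M \<alpha>)" if "\<alpha> \<in> Comp n" for \<alpha> n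
      using S T that unfolding is_antipode_def by simp
    then show ?thesis unfolding *[OF S] *[OF T] by (intro sum.cong) auto
  qed
qed

lemma ex_antipode:
  "\<exists>S :: 'k::{comm_ring, semiring_numeral} power_series \<Rightarrow> 'k power_series. is_antipode S"
proof -
  define C where "C m = {\<alpha> \<in> Comp (mdeg m). Des (expo m) \<subseteq> Des (rev \<alpha>)}" for m
  define S0 :: "'k power_series \<Rightarrow> 'k power_series" where
    "S0 f = (\<lambda>m. \<Sum>\<alpha>\<in>C m. (- 1) ^ length \<alpha> * f (monom [0..<length \<alpha>] \<alpha>))" for f
  have posC: "\<forall>a\<in>set \<alpha>. 0 < a" if "\<alpha> \<in> Comp n" for \<alpha> n using that by (simp add: Comp_def)
  have degC: "mdeg (monom [0..<length \<alpha>] \<alpha>) = n" if "\<alpha> \<in> Comp n" for \<alpha> n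
    using that expo_std[OF posC[OF that]] sum_list_expo by (metis (mono_tags, lifting) Comp_def mem_Collect_eq)
  have S0_QSym: "S0 f \<in> QSym" if f: "f \<in> QSym" for f
  proof -
    obtain d where d: "\<forall>m. f m \<noteq> 0 \<longrightarrow> mdeg m \<le> d" using QSym_bounded[OF f] by blast
    have "mdeg m \<le> d" if nz: "S0 f m \<noteq> 0" for m
    proof -
      obtain \<alpha> where \<alpha>: "\<alpha> \<in> C m" "(- 1) ^ length \<alpha> * f (monom [0..<length \<alpha>] \<alpha>) \<noteq> 0"
        by (rule sum.not_neutral_contains_not_neutral[OF nz[unfolded S0_def]])
      then have "f (monom [0..<length \<alpha>] \<alpha>) \<noteq> 0" by (metis mult_zero_right)
      with d \<alpha>(1) degC show ?thesis by (metis (mono_tags, lifting) C_def mem_Collect_eq)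
    qed
    moreover have "S0 f m = S0 f m'" if "expo m = expo m'" for m m'
      using that sum_list_expo[of m] sum_list_expo[of m'] by (simp add: S0_def C_def)
    ultimately show ?thesis unfolding QSym_iff by blast
  qed
  have S0_M: "S0 (M \<alpha>) =
      scale ((- 1) ^ length \<alpha>) (\<Sum>\<gamma>\<in>{\<gamma> \<in> Comp n. Des \<gamma> \<subseteq> Des (rev \<alpha>)}. M \<gamma>)"
    if \<alpha>: "\<alpha> \<in> Comp n" for \<alpha> n
  proof
    fix m
    let ?D = "{\<gamma> \<in> Comp n. Des \<gamma> \<subseteq> Des (rev \<alpha>)}"
    have finC: "finite (C m)" and finD: "finite ?D" by (simp_all add: C_def finite_Comp)
    have "S0 (M \<alpha>) m = (\<Sum>\<beta>\<in>C m. if \<beta> = \<alpha> then (- 1) ^ length \<alpha> else 0)"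
      unfolding S0_def
      by (intro sum.cong refl) (auto simp: M_eq[OF posC[OF \<alpha>]] expo_std[OF posC] C_def)
    also have "\<dots> = (if \<alpha> \<in> C m then (- 1) ^ length \<alpha> else 0)" using finC by simp
    also have "\<alpha> \<in> C m \<longleftrightarrow> expo m \<in> ?D"
      using \<alpha> expo_Comp[of m] by (auto simp: C_def Comp_def)
    finally have L: "S0 (M \<alpha>) m = (if expo m \<in> ?D then (- 1) ^ length \<alpha> else 0)" .
    have "(\<Sum>\<gamma>\<in>?D. M \<gamma>) m = (\<Sum>\<gamma>\<in>?D. if \<gamma> = expo m then (1::'k) else 0)"
      unfolding sum_power_series_apply by (intro sum.cong refl) (auto simp: M_eq posC)
    also have "\<dots> = (if expo m \<in> ?D then 1 else 0)" using finD by simp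
    finally show "S0 (M \<alpha>) m = scale ((- 1) ^ length \<alpha>) (\<Sum>\<gamma>\<in>?D. M \<gamma>) m"
      using L by (simp add: scale_def)
  qed
  have lin: "S0 (f + g) = S0 f + S0 g" "S0 (scale c f) = scale c (S0 f)" for f g c
    by (auto simp: S0_def scale_def fun_eq_iff sum.distrib sum_distrib_left algebra_simps)
  have "is_antipode (restrict S0 QSym)"
    unfolding is_antipode_def linear_on_QSym_def
    using S0_QSym S0_M lin by (auto simp: add_QSym scale_QSym M_QSym)
  then show ?thesis by (rule exI[where P = is_antipode])
qed

theorem ex1_antipode:
  "\<exists>!S :: 'k::{comm_ring, semiring_numeral} power_series \<Rightarrow> 'k power_series. is_antipode S"
  by (rule ex_ex1I[where P = is_antipode, OF ex_antipode is_antipode_unique])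

lemma is_antipode_antipode: "is_antipode antipode"
  unfolding antipode_def by (rule theI'[where P = is_antipode, OF ex1_antipode])

end

theory Submission
  imports Defs
begin

text \<open>
  Taking descent sets identifies the compositions of \<open>n > 0\<close> with the subsets of
  \<open>{1, \<dots>, n - 1}\<close>; the length of a composition is one more than the size of its descent set, and
  reversal acts on descent sets by \<open>x \<mapsto> n - x\<close>. Expanding \<open>S(\<eta>\<^sub>\<alpha>)\<close> in the
  monomial basis, the coefficient of \<open>M\<^sub>\<gamma>\<close> is therefore the sum of \<open>(- 2)\<close> to the power
  \<open>card D + 1\<close> over all \<open>D\<close> between \<open>Des (rev \<gamma>)\<close> and \<open>Des \<alpha>\<close>, which the binomial theorem
  evaluates because \<open>1 - 2 = - 1\<close>.
\<close>

section \<open>Compositions of n and subsets of {1, ..., n - 1}\<close>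

text \<open>The total of the old composition becomes a proper prefix sum once a part is appended.
  For the empty composition this fails: \<open>Des [a]\<close> is empty, yet 0 would be inserted.
  The inductions on the last part below all rest on this recursion.\<close>

lemma Des_append_single:
  assumes "\<alpha> \<noteq> []"
  shows "Des (\<alpha> @ [a]) = insert (sum_list \<alpha>) (Des \<alpha>)"
proof (intro set_eqI iffI)
  fix x assume "x \<in> Des (\<alpha> @ [a])"
  then obtain k where k: "x = sum_list (take k (\<alpha> @ [a]))" "1 \<le> k" "k \<le> length \<alpha>"
    by (auto simp: Des_def)
  then show "x \<in> insert (sum_list \<alpha>) (Des \<alpha>)"
    by (cases "k = length \<alpha>") (auto simp: Des_def)
next
  fix x assume "x \<in> insert (sum_list \<alpha>) (Des \<alpha>)"
  then consider "x = sum_list \<alpha>" | k where "x = sum_list (take k \<alpha>)" "1 \<le> k" "k < length \<alpha>"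
    by (auto simp: Des_def)
  then show "x \<in> Des (\<alpha> @ [a])"
  proof cases
    case 1
    then show ?thesis using assms
      by (auto simp: Des_def Suc_le_eq intro!: exI[of _ "length \<alpha>"])
  next
    case 2
    then show ?thesis by (auto simp: Des_def intro!: exI[of _ k])
  qed
qed

lemma Des_Nil [simp]: "Des [] = {}"
  and Des_single [simp]: "Des [a] = {}"
  by (auto simp: Des_def)

lemma Des_subset:
  "\<alpha> \<in> Comp n \<Longrightarrow> Des \<alpha> \<subseteq> {0<..<n}"
proof (induction \<alpha> arbitrary: n rule: rev_induct)
  case (snoc a \<alpha>)
  then have \<alpha>: "\<alpha> \<in> Comp (sum_list \<alpha>)" "0 < a" "n = sum_list \<alpha> + a"
    by (auto simp: Comp_def)
  show ?case
  proof (cases "\<alpha> = []")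
    case False
    then have "0 < sum_list \<alpha>" using \<alpha>(1) by (cases \<alpha>) (auto simp: Comp_def)
    then show ?thesis using snoc.IH[OF \<alpha>(1)] \<alpha> False by (fastforce simp: Des_append_single)
  qed simp
qed simp

lemma finite_Des: "\<alpha> \<in> Comp n \<Longrightarrow> finite (Des \<alpha>)"
  using Des_subset finite_subset by blast

text \<open>Each part after the first contributes one new descent, because the sum of the preceding
  parts exceeds all earlier descents. The condition \<open>0 < n\<close> excludes the empty
  composition, whose length is 0 and not 1.\<close>

lemma length_eq_card_Des:
  "\<alpha> \<in> Comp n \<Longrightarrow> 0 < n \<Longrightarrow> length \<alpha> = Suc (card (Des \<alpha>))"
proof (induction \<alpha> arbitrary: n rule: rev_induct)
  case Nil
  then show ?case by (simp add: Comp_def)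
next
  case (snoc a \<alpha>)
  then have \<alpha>: "\<alpha> \<in> Comp (sum_list \<alpha>)" by (auto simp: Comp_def)
  show ?case
  proof (cases "\<alpha> = []")
    case False
    then have "0 < sum_list \<alpha>" using \<alpha> by (cases \<alpha>) (auto simp: Comp_def)
    moreover have "sum_list \<alpha> \<notin> Des \<alpha>" using Des_subset[OF \<alpha>] by auto
    ultimately show ?thesis
      using snoc.IH[OF \<alpha>] finite_Des[OF \<alpha>] False by (simp add: Des_append_single)
  qed simp
qed

text \<open>This recovers the data of the prefix from the descent set: the largest descent is its
  total, and the other descents are its own.\<close>

lemma Max_Des_append_single:
  assumes "\<alpha> \<in> Comp (sum_list \<alpha>)" "\<alpha> \<noteq> []"
  shows "Max (Des (\<alpha> @ [a])) = sum_list \<alpha>" and "Des (\<alpha> @ [a]) - {sum_list \<alpha>} = Des \<alpha>"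
proof -
  show "Max (Des (\<alpha> @ [a])) = sum_list \<alpha>"
    using Des_subset[OF assms(1)] finite_Des[OF assms(1)] assms(2)
    by (intro Max_eqI) (auto simp: Des_append_single)
  show "Des (\<alpha> @ [a]) - {sum_list \<alpha>} = Des \<alpha>"
    using Des_subset[OF assms(1)] assms(2) by (auto simp: Des_append_single)
qed

text \<open>Induction on the last part: the largest descent fixes the total of the prefix and hence,
  n being given, the last part; removing it leaves the descent set of the prefix.\<close>

lemma Des_inject:
  "\<alpha> \<in> Comp n \<Longrightarrow> \<beta> \<in> Comp n \<Longrightarrow> Des \<alpha> = Des \<beta> \<Longrightarrow> \<alpha> = \<beta>"
proof (induction \<alpha> arbitrary: n \<beta> rule: rev_induct)
  case Nil
  then show ?case by (cases \<beta>) (auto simp: Comp_def)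
next
  case (snoc a \<alpha>)
  have "\<beta> \<noteq> []" using snoc.prems by (auto simp: Comp_def)
  then obtain \<beta>' b where \<beta>: "\<beta> = \<beta>' @ [b]" by (metis rev_exhaust)
  have C: "\<alpha> \<in> Comp (sum_list \<alpha>)" "\<beta>' \<in> Comp (sum_list \<beta>')"
    and s: "sum_list \<alpha> + a = sum_list \<beta>' + b"
    using snoc.prems \<beta> by (auto simp: Comp_def)
  have eq: "Des (\<alpha> @ [a]) = Des (\<beta>' @ [b])" using snoc.prems \<beta> by simp
  \<comment> \<open>Only a one-part composition has no descents, so the descent set shows whether
    the prefix is empty.\<close>
  have nil: "\<alpha> = [] \<longleftrightarrow> \<beta>' = []" using eq
    by (metis Des_append_single Des_single append_Nil insert_not_empty)
  show ?case
  proof (cases "\<alpha> = []")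
    case True
    then show ?thesis using nil s \<beta> by simp
  next
    case False
    note A = Max_Des_append_single[OF C(1) False, of a]
    note B = Max_Des_append_single[OF C(2), of b]
    have sum: "sum_list \<alpha> = sum_list \<beta>'" using A(1) B(1) eq nil False by simp
    moreover have "Des \<alpha> = Des \<beta>'" using A(2) B(2) eq nil False sum by simp
    ultimately have "\<alpha> = \<beta>'" using snoc.IH[OF C(1), of \<beta>'] C(2) by simp
    then show ?thesis using s \<beta> by simp
  qed
qed

text \<open>The composition is built from the right: \<open>Max D\<close> is the total of all parts
  but the last, which is \<open>n - Max D\<close>; the smaller descents are realized by induction on
  the total.\<close>

lemma Des_surj:
  "D \<subseteq> {0<..<n} \<Longrightarrow> \<exists>\<alpha>\<in>Comp n. Des \<alpha> = D"
proof (induction n arbitrary: D rule: less_induct)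
  case (less n)
  have fin: "finite D" using less.prems finite_subset by blast
  show ?case
  proof (cases "D = {}")
    case True
    show ?thesis
    \<comment> \<open>The witness depends on n, since \<open>[0]\<close> is not a
      composition.\<close>
    proof (cases "n = 0")
      case True
      then show ?thesis using \<open>D = {}\<close> by (intro bexI[of _ "[]"]) (auto simp: Comp_def)
    next
      case False
      then show ?thesis using \<open>D = {}\<close> by (intro bexI[of _ "[n]"]) (auto simp: Comp_def)
    qed
  next
    case False
    then have m: "Max D \<in> D" using fin by simp
    then have m': "0 < Max D" "Max D < n" using less.prems by auto
    have "D - {Max D} \<subseteq> {0<..<Max D}"
    proof
      fix x assume "x \<in> D - {Max D}"
      then show "x \<in> {0<..<Max D}" using less.prems Max_ge[OF fin, of x] by auto
    qed
    then obtain \<alpha> where \<alpha>: "\<alpha> \<in> Comp (Max D)" "Des \<alpha> = D - {Max D}"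
      using less.IH[OF m'(2)] by blast
    then have sum: "sum_list \<alpha> = Max D" by (simp add: Comp_def)
    then have "\<alpha> \<noteq> []" using m'(1) by (metis less_irrefl sum_list.Nil)
    then have "Des (\<alpha> @ [n - Max D]) = D"
      using m by (simp add: Des_append_single sum \<alpha>(2) insert_absorb)
    moreover have "\<alpha> @ [n - Max D] \<in> Comp n" using \<alpha>(1) m'(2) by (auto simp: Comp_def)
    ultimately show ?thesis by blast
  qed
qed

lemma bij_betw_Des: "bij_betw Des (Comp n) (Pow {0<..<n})"
proof (rule bij_betw_imageI)
  show "inj_on Des (Comp n)" using Des_inject by (auto intro: inj_onI)
  show "Des ` Comp n = Pow {0<..<n}"
  proof (intro set_eqI iffI)
    fix D assume "D \<in> Pow {0<..<n}"
    then show "D \<in> Des ` Comp n" using Des_surj[of D n] by blast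
  qed (use Des_subset in blast)
qed

section \<open>Reversal and descent sets\<close>

lemma rev_Comp: "\<alpha> \<in> Comp n \<Longrightarrow> rev \<alpha> \<in> Comp n"
  by (simp add: Comp_def sum_list_rev)

text \<open>The complement of a prefix of length k is a suffix with sum n - x, and reversal turns
  this suffix into a prefix.\<close>

lemma Des_rev_subset:
  assumes "\<alpha> \<in> Comp n" "x \<in> Des \<alpha>"
  shows "n - x \<in> Des (rev \<alpha>)"
proof -
  obtain k where k: "x = sum_list (take k \<alpha>)" "1 \<le> k" "k < length \<alpha>"
    using assms(2) by (auto simp: Des_def)
  have "sum_list (take k \<alpha>) + sum_list (drop k \<alpha>) = n"
    using assms(1) by (simp add: Comp_def flip: sum_list_append)
  then have "n - x = sum_list (take (length \<alpha> - k) (rev \<alpha>))"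
    using k by (simp add: take_rev sum_list_rev)
  then show ?thesis using k by (auto simp: Des_def intro!: exI[of _ "length \<alpha> - k"])
qed

text \<open>The map x to n - x is an involution on {1, ..., n - 1}, so it can be applied to both
  sides of the inclusion. This moves the reversal from one composition to the other.\<close>

lemma Des_subset_rev_iff:
  assumes "\<alpha> \<in> Comp n" "\<beta> \<in> Comp n"
  shows "Des \<alpha> \<subseteq> Des (rev \<beta>) \<longleftrightarrow> Des (rev \<alpha>) \<subseteq> Des \<beta>"
proof -
  have *: "Des (rev \<gamma>) \<subseteq> Des \<delta>"
    if \<gamma>: "\<gamma> \<in> Comp n" and \<delta>: "\<delta> \<in> Comp n" and sub: "Des \<gamma> \<subseteq> Des (rev \<delta>)" for \<gamma> \<delta>
  proof
    fix x assume x: "x \<in> Des (rev \<gamma>)"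
    have "n - x \<in> Des (rev \<delta>)" using Des_rev_subset[OF rev_Comp[OF \<gamma>] x] sub by auto
    then have "n - (n - x) \<in> Des \<delta>" using Des_rev_subset[OF rev_Comp[OF \<delta>]] by fastforce
    \<comment> \<open>Subtraction on the naturals is truncated, so \<open>n - (n - x)\<close> equals
      x only for x at most n.\<close>
    moreover have "x < n" using Des_subset[OF rev_Comp[OF \<gamma>]] x by auto
    ultimately show "x \<in> Des \<delta>" by simp
  qed
  show ?thesis using *[OF assms] *[OF assms[THEN rev_Comp]] by auto
qed

section \<open>Signed sums over intervals\<close>

text \<open>Start from the interval consisting of G alone and enlarge its upper end one element at a
  time; each new element multiplies both sides by 1 - 2 = -1.\<close>

lemma sum_interval_signed_power:
  fixes G A :: "'a set"
  assumes "finite A" "G \<subseteq> A"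
  shows "(\<Sum>D | G \<subseteq> D \<and> D \<subseteq> A. (- 1) ^ Suc (card D) * 2 ^ Suc (card D))
       = (- 1) ^ Suc (card A) * (2 ^ Suc (card G) :: 'k::{comm_ring, semiring_numeral})"
proof -
  let ?f = "\<lambda>D::'a set. (- 1) ^ Suc (card D) * (2 ^ Suc (card D) :: 'k)"
  have finG: "finite G" using assms finite_subset by blast
  \<comment> \<open>The induction runs over the part E of the upper end outside G;
    \<open>E = A - G\<close> gives the claim.\<close>
  have "(\<Sum>D | G \<subseteq> D \<and> D \<subseteq> G \<union> E. ?f D) = (- 1) ^ Suc (card (G \<union> E)) * 2 ^ Suc (card G)"
    if "finite E" "G \<inter> E = {}" for E
    using that
  proof (induction E rule: finite_induct)
    case empty
    have "{D. G \<subseteq> D \<and> D \<subseteq> G \<union> {}} = {G}" by auto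
    then show ?case by simp
  next
    case (insert e E)
    let ?I = "{D. G \<subseteq> D \<and> D \<subseteq> G \<union> E}"
    have e: "e \<notin> G \<union> E" and finGE: "finite (G \<union> E)" using insert finG by auto
    have finI: "finite ?I" by (rule finite_subset[of _ "Pow (G \<union> E)"]) (use finGE in auto)
    have eD: "e \<notin> D" "finite D" if "D \<in> ?I" for D
      using that e finGE finite_subset[of D "G \<union> E"] by auto
    have split: "{D. G \<subseteq> D \<and> D \<subseteq> G \<union> insert e E} = ?I \<union> insert e ` ?I"
    proof (intro set_eqI iffI)
      fix D assume D: "D \<in> {D. G \<subseteq> D \<and> D \<subseteq> G \<union> insert e E}"
      show "D \<in> ?I \<union> insert e ` ?I"
      proof (cases "e \<in> D")
        case True
        then have "D = insert e (D - {e})" "D - {e} \<in> ?I" using D e by auto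
        then show ?thesis by blast
      qed (use D in auto)
    qed auto
    have disj: "?I \<inter> insert e ` ?I = {}" using e by auto
    have inj: "inj_on (insert e) ?I" using e by (auto simp: inj_on_def insert_ident)
    have two: "2 * x = x + x" for x :: 'k
      by (metis distrib_right mult_1_left one_add_one)
    \<comment> \<open>Inserting e raises the cardinality by one, so each term gains the factor
      -2.\<close>
    have "(\<Sum>D\<in>insert e ` ?I. ?f D) = (\<Sum>D\<in>?I. - (2 * ?f D))"
      unfolding sum.reindex[OF inj] o_def
      by (intro sum.cong refl) (use eD in \<open>simp add: algebra_simps\<close>)
    also have "\<dots> = - (2 * (\<Sum>D\<in>?I. ?f D))" by (simp only: sum_negf sum_distrib_left)
    finally have "(\<Sum>D | G \<subseteq> D \<and> D \<subseteq> G \<union> insert e E. ?f D) = - (\<Sum>D\<in>?I. ?f D)"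
      unfolding split using finI disj by (simp add: sum.union_disjoint two)
    also have "\<dots> = - ((- 1) ^ Suc (card (G \<union> E)) * 2 ^ Suc (card G))"
      using insert by simp
    also have "\<dots> = (- 1) ^ Suc (card (G \<union> insert e E)) * 2 ^ Suc (card G)"
      using e finGE by simp
    finally show ?case .
  qed
  from this[of "A - G"] assms show ?thesis by (simp add: Un_absorb1)
qed

text \<open>The bijection \<open>Des\<close> carries the compositions summed over to an interval of
  sets and turns lengths into cardinalities plus one. The interval is empty unless
  \<open>Des \<gamma> \<subseteq> Des \<alpha>\<close>.\<close>

lemma sum_Comp_interval_signed_power:
  assumes \<alpha>: "\<alpha> \<in> Comp n" and \<gamma>: "\<gamma> \<in> Comp n"
  shows "(\<Sum>\<beta> | \<beta> \<in> Comp n \<and> Des \<gamma> \<subseteq> Des \<beta> \<and> Des \<beta> \<subseteq> Des \<alpha>. (- 1) ^ length \<beta> * 2 ^ length \<beta>)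
       = (if Des \<gamma> \<subseteq> Des \<alpha> then (- 1) ^ length \<alpha> * 2 ^ length \<gamma>
          else 0 :: 'k::{comm_ring, semiring_numeral})"
    (is "sum _ ?B = _")
\<comment> \<open>For n = 0 the only composition is \<open>[]\<close>, where length and number of
  descents are both 0, so this case is checked directly.\<close>
proof (cases "n = 0")
  case True
  have "\<beta> = []" if "\<beta> \<in> Comp 0" for \<beta> using that by (cases \<beta>) (auto simp: Comp_def)
  then have "\<alpha> = []" "\<gamma> = []" "?B = {[]}" using \<alpha> \<gamma> True by (auto simp: Comp_def)
  then show ?thesis by simp
next
  case False
  then have len: "length \<beta> = Suc (card (Des \<beta>))" if "\<beta> \<in> Comp n" for \<beta>
    using that length_eq_card_Des by simp
  let ?I = "{D. Des \<gamma> \<subseteq> D \<and> D \<subseteq> Des \<alpha>}"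
  have "bij_betw Des ?B ?I"
  proof (rule bij_betw_subset[OF bij_betw_Des])
    show "Des ` ?B = ?I"
    proof (intro set_eqI iffI)
      fix D assume D: "D \<in> ?I"
      then obtain \<beta> where "\<beta> \<in> Comp n" "Des \<beta> = D"
        using Des_surj[of D n] Des_subset[OF \<alpha>] by auto
      then show "D \<in> Des ` ?B" using D by blast
    qed auto
  qed auto
  then have "(\<Sum>\<beta>\<in>?B. (- 1) ^ Suc (card (Des \<beta>)) * 2 ^ Suc (card (Des \<beta>)))
      = (\<Sum>D\<in>?I. (- 1) ^ Suc (card D) * (2 ^ Suc (card D) :: 'k))"
    by (rule sum.reindex_bij_betw)
  moreover have "(\<Sum>\<beta>\<in>?B. (- 1) ^ length \<beta> * (2 ^ length \<beta> :: 'k))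
      = (\<Sum>\<beta>\<in>?B. (- 1) ^ Suc (card (Des \<beta>)) * 2 ^ Suc (card (Des \<beta>)))"
    by (intro sum.cong refl) (simp only: mem_Collect_eq len)
  moreover have "(\<Sum>D\<in>?I. (- 1) ^ Suc (card D) * (2 ^ Suc (card D) :: 'k)) = 0"
    if "\<not> Des \<gamma> \<subseteq> Des \<alpha>"
  proof -
    have "?I = {}" using that by auto
    then show ?thesis by (simp only: sum.empty)
  qed
  ultimately show ?thesis
    using sum_interval_signed_power[OF finite_Des[OF \<alpha>], of "Des \<gamma>", where 'k = 'k]
      len[OF \<alpha>] len[OF \<gamma>] by simp
qed

section \<open>Comparison of coefficients in the monomial basis\<close>

theorem proposition7:
  fixes n :: nat and \<alpha> :: "nat list"
  assumes "\<alpha> \<in> Comp n"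
  shows "antipode (eta \<alpha> :: 'k::{comm_ring, semiring_numeral} power_series)
           = scale ((- 1) ^ length \<alpha>) (eta (rev \<alpha>))"
proof
  fix m
  let ?S = "antipode :: 'k power_series \<Rightarrow> 'k power_series"
  let ?B = "{\<beta> \<in> Comp n. Des \<beta> \<subseteq> Des \<alpha>}"
  let ?R = "\<lambda>\<beta> \<gamma>. Des \<gamma> \<subseteq> Des (rev \<beta>)"
  have S: "linear_on_QSym ?S" "\<And>n \<beta>. \<beta> \<in> Comp n \<Longrightarrow> ?S (M \<beta>) =
      scale ((- 1) ^ length \<beta>) (\<Sum>\<gamma>\<in>{\<gamma> \<in> Comp n. Des \<gamma> \<subseteq> Des (rev \<beta>)}. M \<gamma>)"
    using is_antipode_antipode[where 'a = 'k] by (simp_all add: is_antipode_def)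
  have sum: "sum_list \<alpha> = n" "sum_list (rev \<alpha>) = n"
    using assms by (auto simp: Comp_def sum_list_rev)
  have "?S (eta \<alpha>) = (\<Sum>\<beta>\<in>?B. scale (2 ^ length \<beta>) (?S (M \<beta>)))"
    unfolding eta_def sum by (rule linear_on_QSym_sum) (use S M_QSym in auto)
  also have "\<dots> = (\<Sum>\<beta>\<in>?B. scale (2 ^ length \<beta>)
      (scale ((- 1) ^ length \<beta>) (\<Sum>\<gamma>\<in>{\<gamma> \<in> Comp n. ?R \<beta> \<gamma>}. M \<gamma>)))"
    using S by (intro sum.cong refl) auto
  finally have "?S (eta \<alpha>) m = (\<Sum>\<beta>\<in>?B. \<Sum>\<gamma> | \<gamma> \<in> Comp n \<and> ?R \<beta> \<gamma>. (- 1) ^ length \<beta> * 2 ^ length \<beta> * M \<gamma> m)"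
    by (simp add: sum_power_series_apply scale_def sum_distrib_left mult_ac)
  \<comment> \<open>Exchanging the sums collects, for each \<gamma>, the coefficient of
    \<open>M \<gamma>\<close>.\<close>
  also have "\<dots> = (\<Sum>\<gamma>\<in>Comp n. \<Sum>\<beta> | \<beta> \<in> ?B \<and> ?R \<beta> \<gamma>. (- 1) ^ length \<beta> * 2 ^ length \<beta> * M \<gamma> m)"
    by (rule sum.swap_restrict) (simp_all add: finite_Comp)
  also have "\<dots> = (\<Sum>\<gamma>\<in>Comp n. if ?R \<alpha> \<gamma> then (- 1) ^ length \<alpha> * (2 ^ length \<gamma> * M \<gamma> m) else 0)"
  proof (intro sum.cong refl)
    fix \<gamma> assume \<gamma>: "\<gamma> \<in> Comp n"
    \<comment> \<open>With the reversal moved from \<beta> to the fixed \<gamma>, the two conditions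
      on \<open>Des \<beta>\<close> describe an interval.\<close>
    have "{\<beta>. \<beta> \<in> ?B \<and> ?R \<beta> \<gamma>} = {\<beta>. \<beta> \<in> Comp n \<and> Des (rev \<gamma>) \<subseteq> Des \<beta> \<and> Des \<beta> \<subseteq> Des \<alpha>}"
      using Des_subset_rev_iff[OF \<gamma>] by auto
    then show "(\<Sum>\<beta> | \<beta> \<in> ?B \<and> ?R \<beta> \<gamma>. (- 1) ^ length \<beta> * 2 ^ length \<beta> * M \<gamma> m)
        = (if ?R \<alpha> \<gamma> then (- 1) ^ length \<alpha> * (2 ^ length \<gamma> * M \<gamma> m) else (0 :: 'k))"
      using sum_Comp_interval_signed_power[OF assms rev_Comp[OF \<gamma>], where 'k = 'k]
        Des_subset_rev_iff[OF \<gamma> assms]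
      by (simp add: mult.assoc[symmetric] flip: sum_distrib_right)
  qed
  \<comment> \<open>The surviving condition on \<gamma> is exactly the one that indexes
    \<open>eta (rev \<alpha>)\<close>.\<close>
  also have "\<dots> = (\<Sum>\<gamma> | \<gamma> \<in> Comp n \<and> ?R \<alpha> \<gamma>. (- 1) ^ length \<alpha> * (2 ^ length \<gamma> * M \<gamma> m))"
    by (rule sum.inter_filter[symmetric]) (rule finite_Comp)
  also have "\<dots> = scale ((- 1) ^ length \<alpha>) (eta (rev \<alpha>)) m"
    unfolding eta_def sum by (simp add: sum_power_series_apply scale_def sum_distrib_left)
  finally show "?S (eta \<alpha>) m = scale ((- 1) ^ length \<alpha>) (eta (rev \<alpha>)) m" .
qed

end
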